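(* Let $G$ be a $\Delta$-regular graph with girth at least $5$. Then $G$ has a strong edge-coloring that uses (at most) $2\Delta^2-3\Delta+2$ colors.
   Context: Graphs are finite and simple. The girth of a graph is the length of its shortest cycle (infinite if the graph has no cycle). Two distinct edges are of distance at most two if either they share an endpoint or some endpoint of one is adjacent to some endpoint of the other. A strong edge-coloring of $G$ is an assignment of colors to all edges of $G$ such that no two distinct edges of distance at most two receive the same color.
   Formalization: The case of 2-regular graphs of girth exactly 5 is excluded, because such a graph contains a 5-cycle component, which needs 5 colors, while the stated bound gives only 4. *)

theory Defs
  imports Main "HOL-Library.Extended_Nat"
begin

definition simple_graph :: "'a set \<Rightarrow> 'a set set \<Rightarrow> bool" where
  "simple_graph V E \<longleftrightarrow> finite V \<and> (\<forall>e\<in>E. e \<subseteq> V \<and> card e = 2)"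

definition degree :: "'a set set \<Rightarrow> 'a \<Rightarrow> nat" where
  "degree E v = card {e \<in> E. v \<in> e}"

definition regular :: "'a set \<Rightarrow> 'a set set \<Rightarrow> nat \<Rightarrow> bool" where
  "regular V E d \<longleftrightarrow> (\<forall>v\<in>V. degree E v = d)"

(* A cycle is listed by its vertices, without repeating the first one at the end;
   the edge closing the cycle is the case Suc i = length p. *)
definition is_cycle :: "'a set set \<Rightarrow> 'a list \<Rightarrow> bool" where
  "is_cycle E p \<longleftrightarrow> length p \<ge> 3 \<and> distinct p \<and>
     (\<forall>i < length p. {p ! i, p ! (Suc i mod length p)} \<in> E)"

(* The infimum of the empty set in enat is \<infinity>, so acyclic graphs have girth \<infinity>. *)
definition girth :: "'a set set \<Rightarrow> enat" where
  "girth E = (INF p \<in> {p. is_cycle E p}. enat (length p))"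

definition within_distance_two :: "'a set set \<Rightarrow> 'a set \<Rightarrow> 'a set \<Rightarrow> bool" where
  "within_distance_two E e f \<longleftrightarrow>
     e \<inter> f \<noteq> {} \<or> (\<exists>x\<in>e. \<exists>y\<in>f. {x, y} \<in> E)"

definition strong_edge_coloring :: "'a set set \<Rightarrow> ('a set \<Rightarrow> 'c) \<Rightarrow> bool" where
  "strong_edge_coloring E c \<longleftrightarrow>
     (\<forall>e\<in>E. \<forall>f\<in>E. e \<noteq> f \<and> within_distance_two E e f \<longrightarrow> c e \<noteq> c f)"

end

theory Submission
  imports Defs
begin

text \<open>In the conflict graph on the edges, every edge has at most \<open>2\<Delta>(\<Delta> - 1)\<close> neighbours.
  Fix a root \<open>r\<close> in each component and choose, for every neighbour \<open>v\<close> of \<open>r\<close>, a further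
  neighbour \<open>f v \<noteq> r\<close> of \<open>v\<close>, such that the chosen vertices are pairwise nonadjacent. The edges
  \<open>{v, f v}\<close> do not conflict, so all of them share one colour, yet every edge at
  \<open>r\<close> conflicts with all \<open>\<Delta>\<close> of them. The remaining edges are
  \<open>(2\<Delta>(\<Delta> - 1) - \<Delta>)\<close>-degenerate: in a nonempty set \<open>Y\<close> of them, either some edge
  contains a root, or some edge has an endpoint adjacent to a vertex \<open>p\<close> untouched by \<open>Y\<close>,
  and then the \<open>\<Delta>\<close> edges at \<open>p\<close> conflict with it and lie outside \<open>Y\<close>.

  The choice \<open>f\<close> is greedy: each chosen vertex blocks at most one of the \<open>\<Delta> - 1\<close> candidates at
  any later \<open>v\<close>, so only the last step can fail. It does not fail if some chosen vertex blocks
  nothing there, or if two chosen vertices block the same candidate. Given a candidate \<open>b\<close>, either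
  \<open>b\<close> blocks nothing at some \<open>v\<close>, which is then put last, or (the exception being the 5-cycle)
  two neighbours of \<open>b\<close> are chosen first and the part of \<open>b\<close> is put last.\<close>

section \<open>Greedy colouring of a degenerate conflict relation\<close>

text \<open>Delete an element with fewer than \<open>k\<close> conflicts, colour the rest by
  induction, and give it a colour below \<open>k\<close> that its conflicts leave free.\<close>

lemma degenerate_coloring:
  fixes conf :: "'b \<Rightarrow> 'b \<Rightarrow> bool"
  assumes "finite Q" and sym: "\<And>x y. conf x y \<Longrightarrow> conf y x"
    and deg: "\<And>Y. Y \<subseteq> Q \<Longrightarrow> Y \<noteq> {} \<Longrightarrow> \<exists>y\<in>Y. card {z \<in> Y. z \<noteq> y \<and> conf y z} < k"
  shows "\<exists>c. (\<forall>x\<in>Q. c x < k) \<and> (\<forall>x\<in>Q. \<forall>y\<in>Q. x \<noteq> y \<and> conf x y \<longrightarrow> c x \<noteq> c y)"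
  using assms(1) deg
proof (induction Q rule: finite_psubset_induct)
  case (psubset Q)
  show ?case
  proof (cases "Q = {}")
    case False
    then obtain y where y: "y \<in> Q" "card {z \<in> Q. z \<noteq> y \<and> conf y z} < k"
      using psubset.prems[of Q] by auto
    have "\<exists>c. (\<forall>x\<in>Q - {y}. c x < k) \<and>
        (\<forall>x\<in>Q - {y}. \<forall>z\<in>Q - {y}. x \<noteq> z \<and> conf x z \<longrightarrow> c x \<noteq> c z)"
    proof (rule psubset.IH)
      show "Q - {y} \<subset> Q" using y(1) by blast
      show "\<exists>y\<in>Y. card {z \<in> Y. z \<noteq> y \<and> conf y z} < k" if "Y \<subseteq> Q - {y}" "Y \<noteq> {}" for Y
        using that by (intro psubset.prems) blast+
    qed
    then obtain c where c: "\<forall>x\<in>Q - {y}. c x < k"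
        "\<forall>x\<in>Q - {y}. \<forall>z\<in>Q - {y}. x \<noteq> z \<and> conf x z \<longrightarrow> c x \<noteq> c z"
      by blast
    let ?S = "{z \<in> Q. z \<noteq> y \<and> conf y z}"
    have "card (c ` ?S) < card {..<k}"
      using card_image_le[of ?S c] psubset.hyps y(2) by simp
    then have "\<not> {..<k} \<subseteq> c ` ?S"
      using card_mono[of "c ` ?S" "{..<k}"] \<open>finite Q\<close> by fastforce
    then obtain a where a: "a < k" "a \<notin> c ` ?S" by blast
    have "\<forall>x\<in>Q. (c(y := a)) x < k" using c(1) a(1) by auto
    moreover have "(c(y := a)) x \<noteq> (c(y := a)) z"
      if "x \<in> Q" "z \<in> Q" "x \<noteq> z" "conf x z" for x z
      using that c(2) a(2) sym[of x z] by (cases "x = y"; cases "z = y") auto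
    ultimately show ?thesis by blast
  qed auto
qed

section \<open>Neighbourhoods, the forbidden short cycles, and the number of conflicts of an
  edge\<close>

definition nbrs :: "'a set set \<Rightarrow> 'a \<Rightarrow> 'a set" where
  "nbrs E v = {w. {v, w} \<in> E}"

lemma nbrs_sym: "w \<in> nbrs E v \<longleftrightarrow> v \<in> nbrs E w"
  by (simp add: nbrs_def insert_commute)

lemma within_distance_two_sym: "within_distance_two E e f \<Longrightarrow> within_distance_two E f e"
  unfolding within_distance_two_def by (metis Int_commute insert_commute)

text \<open>The girth enters only through forbidden short cycles. Pentagons are excluded just for
  \<open>d = 2\<close>. Without a vertex set, regularity is assumed at the vertices that have a
  neighbour.\<close>

locale regular_girth_graph =
  fixes E :: "'a set set" and d :: nat
  assumes finite_edges: "finite E"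
    and edge_card: "e \<in> E \<Longrightarrow> card e = 2"
    and card_nbrs: "w \<in> nbrs E v \<Longrightarrow> card (nbrs E v) = d"
    and two_le_degree: "2 \<le> d"
    and no_triangle: "\<lbrakk>a \<in> nbrs E b; b \<in> nbrs E c\<rbrakk> \<Longrightarrow> c \<notin> nbrs E a"
    and no_square: "\<lbrakk>a \<noteq> b; x \<in> nbrs E a; x \<in> nbrs E b; y \<in> nbrs E a; y \<in> nbrs E b\<rbrakk> \<Longrightarrow> x = y"
    and no_pentagon: "\<lbrakk>d = 2; distinct [v, w, x, y, z]; w \<in> nbrs E v; x \<in> nbrs E w;
        y \<in> nbrs E x; z \<in> nbrs E y\<rbrakk> \<Longrightarrow> v \<notin> nbrs E z"
begin

lemma nbrs_irrefl: "v \<notin> nbrs E v"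
  using edge_card[of "{v}"] by (auto simp: nbrs_def)

lemma edge_form:
  assumes "e \<in> E" "u \<in> e"
  obtains v where "e = {u, v}" "v \<in> nbrs E u"
proof -
  obtain a b where "e = {a, b}" "a \<noteq> b"
    using edge_card[OF assms(1)] by (auto simp: card_2_iff)
  with assms that show thesis by (auto simp: nbrs_def insert_commute)
qed

lemma finite_nbrs: "finite (nbrs E v)"
proof (cases "nbrs E v = {}")
  case False
  then show ?thesis using card_nbrs two_le_degree
    by (metis card.infinite ex_in_conv not_numeral_le_zero)
qed auto

lemma edges_at: "{e \<in> E. v \<in> e} = (\<lambda>w. {v, w}) ` nbrs E v"
  by (auto simp: nbrs_def elim!: edge_form)

lemma card_edges_at: "w \<in> nbrs E v \<Longrightarrow> card {e \<in> E. v \<in> e} = d"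
  unfolding edges_at by (subst card_image) (auto simp: inj_on_def doubleton_eq_iff card_nbrs)

text \<open>Each conflicting edge contains a neighbour of one end of \<open>e\<close> other than the
  opposite end; there are at most \<open>2 * (d - 1)\<close> such vertices, with \<open>d\<close>
  edges at each.\<close>

lemma card_conflicts_le:
  assumes "e \<in> E"
  shows "card {f \<in> E. f \<noteq> e \<and> within_distance_two E e f} \<le> 2 * d * (d - 1)"
proof -
  have "card e = 2" using edge_card assms by blast
  then obtain u v where uv: "e = {u, v}" "u \<noteq> v" by (auto simp: card_2_iff)
  have vu: "v \<in> nbrs E u" "u \<in> nbrs E v"
    using assms uv by (auto simp: nbrs_def insert_commute)
  define B where "B a b = (\<Union>w \<in> nbrs E a - {b}. {f \<in> E. w \<in> f})" for a b
  have cardB: "card (B a b) \<le> d * (d - 1)" if "b \<in> nbrs E a" for a b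
  proof -
    have "card (B a b) \<le> (\<Sum>w \<in> nbrs E a - {b}. card {f \<in> E. w \<in> f})"
      unfolding B_def by (rule card_UN_le) (simp add: finite_nbrs)
    also have "\<dots> = (\<Sum>w \<in> nbrs E a - {b}. d)"
      by (rule sum.cong) (auto intro: card_edges_at simp: nbrs_sym[of _ _ a])
    also have "\<dots> = d * (d - 1)"
      using that card_nbrs[OF that] by (simp add: finite_nbrs)
    finally show ?thesis .
  qed
  have "f \<in> B u v \<union> B v u" if f: "f \<in> E" "f \<noteq> e" "within_distance_two E e f" for f
  proof -
    have "\<exists>x\<in>f. x \<in> nbrs E u \<union> nbrs E v"
      using f(3) vu unfolding within_distance_two_def uv(1)
      by (auto simp: nbrs_def)
    then obtain x where x: "x \<in> f" "x \<in> nbrs E u \<union> nbrs E v" by blast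
    obtain y where y: "f = {x, y}" "y \<in> nbrs E x" using edge_form f(1) x(1) by blast
    show ?thesis
    \<comment> \<open>If \<open>f\<close> meets \<open>e\<close> in \<open>x\<close>, the other end
      \<open>y\<close> of \<open>f\<close> is the required neighbour.\<close>
    proof (cases "x \<in> {u, v}")
      case True
      then have "y \<notin> {u, v}" using f(2) y uv nbrs_irrefl by (auto simp: insert_commute)
      then show ?thesis using True y f(1) unfolding B_def by auto
    next
      case False
      then show ?thesis using x f(1) unfolding B_def by auto
    qed
  qed
  then have "{f \<in> E. f \<noteq> e \<and> within_distance_two E e f} \<subseteq> B u v \<union> B v u" by blast
  moreover have "finite (B u v \<union> B v u)"
    using finite_edges finite_nbrs unfolding B_def by auto
  ultimately have "card {f \<in> E. f \<noteq> e \<and> within_distance_two E e f} \<le> card (B u v \<union> B v u)"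
    by (rule card_mono[rotated])
  also have "\<dots> \<le> 2 * d * (d - 1)"
    using card_Un_le[of "B u v" "B v u"] cardB[OF vu(1)] cardB[OF vu(2)] by simp
  finally show ?thesis .
qed

section \<open>Choosing pairwise nonadjacent second neighbours of a root\<close>

definition indep_choice :: "'a \<Rightarrow> 'a set \<Rightarrow> ('a \<Rightarrow> 'a) \<Rightarrow> bool" where
  "indep_choice r I f \<longleftrightarrow> (\<forall>i\<in>I. f i \<in> nbrs E i - {r}) \<and> (\<forall>i\<in>I. \<forall>j\<in>I. f i \<notin> nbrs E (f j))"

context
  fixes r :: 'a
begin

text \<open>The vertex \<open>y\<close> differs from \<open>j\<close>, since otherwise
  \<open>r\<close>, \<open>i\<close>, \<open>j\<close> would form a triangle; two distinct vertices
  have at most one common neighbour.\<close>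

lemma second_nbr_unique:
  assumes "i \<in> nbrs E r" "j \<in> nbrs E r" "y \<in> nbrs E i - {r}"
    "x \<in> nbrs E y" "x \<in> nbrs E j" "x' \<in> nbrs E y" "x' \<in> nbrs E j"
  shows "x = x'"
proof -
  have "y \<noteq> j"
    using assms no_triangle by (meson nbrs_sym DiffE)
  then show ?thesis using assms no_square by blast
qed

lemma card_second_nbrs: "i \<in> nbrs E r \<Longrightarrow> card (nbrs E i - {r}) = d - 1"
  by (metis card_Diff_singleton card_nbrs nbrs_sym)

lemma card_blocked_le_1:
  assumes "i \<in> nbrs E r" "j \<in> nbrs E r" "y \<in> nbrs E i - {r}"
  shows "card (nbrs E y \<inter> (nbrs E j - {r})) \<le> 1"
  using second_nbr_unique[OF assms] finite_nbrs
  by (subst One_nat_def, subst card_le_Suc0_iff_eq) auto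

text \<open>The union in \<open>small\<close> is the set of blocked candidates at \<open>j\<close>.
  Earlier choices stay fixed, so what they block later can still be counted.\<close>

lemma indep_choice_extend:
  assumes f: "indep_choice r I f" and I: "I \<subseteq> nbrs E r" "j \<in> nbrs E r" "j \<notin> I"
    and small: "card (\<Union>i\<in>I. nbrs E (f i) \<inter> (nbrs E j - {r})) < d - 1"
  shows "\<exists>f'. indep_choice r (insert j I) f' \<and> (\<forall>i\<in>I. f' i = f i)"
proof -
  let ?B = "\<Union>i\<in>I. nbrs E (f i) \<inter> (nbrs E j - {r})"
  have "\<not> nbrs E j - {r} \<subseteq> ?B"
  proof
    assume "nbrs E j - {r} \<subseteq> ?B"
    moreover have "finite ?B" using finite_subset[OF I(1) finite_nbrs] finite_nbrs by auto
    ultimately have "card (nbrs E j - {r}) \<le> card ?B" by (rule card_mono[rotated])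
    then show False using small card_second_nbrs[OF I(2)] by simp
  qed
  then obtain y where y: "y \<in> nbrs E j - {r}" "y \<notin> ?B" by blast
  then have "\<forall>i\<in>I. y \<notin> nbrs E (f i) \<and> f i \<notin> nbrs E y" using nbrs_sym by fast
  then have "indep_choice r (insert j I) (f(j := y))"
    using f I(3) y(1) nbrs_irrefl unfolding indep_choice_def by auto
  then show ?thesis using I(3) by (intro exI[of _ "f(j := y)"]) auto
qed

lemma card_blocked_le:
  assumes f: "indep_choice r I f" and I: "I \<subseteq> nbrs E r" "j \<in> nbrs E r"
  shows "card (\<Union>i\<in>I. nbrs E (f i) \<inter> (nbrs E j - {r})) \<le> card I"
proof -
  have "card (\<Union>i\<in>I. nbrs E (f i) \<inter> (nbrs E j - {r}))
      \<le> (\<Sum>i\<in>I. card (nbrs E (f i) \<inter> (nbrs E j - {r})))"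
    using finite_subset[OF I(1) finite_nbrs] by (rule card_UN_le)
  also have "\<dots> \<le> (\<Sum>i\<in>I. 1)"
  proof (rule sum_mono)
    fix i assume "i \<in> I"
    then show "card (nbrs E (f i) \<inter> (nbrs E j - {r})) \<le> 1"
      using f I unfolding indep_choice_def by (intro card_blocked_le_1[of i]) auto
  qed
  finally show ?thesis by simp
qed

lemma indep_choice_extend_many:
  assumes "finite J" "indep_choice r I f" "I \<subseteq> nbrs E r" "J \<subseteq> nbrs E r" "I \<inter> J = {}"
    "card I + card J < d"
  shows "\<exists>f'. indep_choice r (I \<union> J) f' \<and> (\<forall>i\<in>I. f' i = f i)"
  using assms
proof (induction J rule: finite_induct)
  case (insert j J)
  then obtain g where g: "indep_choice r (I \<union> J) g" "\<forall>i\<in>I. g i = f i" by auto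
  have "card (\<Union>i\<in>I \<union> J. nbrs E (g i) \<inter> (nbrs E j - {r})) \<le> card (I \<union> J)"
    using insert.prems g(1) by (intro card_blocked_le) auto
  \<comment> \<open>The part \<open>j\<close> is itself counted in the bound \<open>d\<close>, so at
    most \<open>d - 2\<close> choices precede it.\<close>
  also have "\<dots> < d - 1"
    using insert.prems(5) insert.hyps card_Un_le[of I J] by simp
  finally have "\<exists>f'. indep_choice r (insert j (I \<union> J)) f' \<and> (\<forall>i\<in>I \<union> J. f' i = g i)"
    using insert.prems insert.hyps g(1) by (intro indep_choice_extend) auto
  then show ?case using g(2) by (metis Un_iff Un_insert_right)
qed auto

text \<open>The hypothesis \<open>small\<close> saves one blocked candidate at \<open>j\<close>.
  With \<open>j\<close> served last, the other \<open>d - 1\<close> parts block at most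
  \<open>d - 2\<close> of its \<open>d - 1\<close> candidates.\<close>

lemma indep_choice_complete:
  assumes f: "indep_choice r I f" and I: "I \<subseteq> nbrs E r" "j \<in> nbrs E r" "j \<notin> I" "I \<noteq> {}"
    and small: "card (\<Union>i\<in>I. nbrs E (f i) \<inter> (nbrs E j - {r})) < card I"
  shows "\<exists>f'. indep_choice r (nbrs E r) f'"
proof -
  define J where "J = nbrs E r - {j} - I"
  have fin: "finite I" "finite J" using finite_subset[OF I(1) finite_nbrs] finite_nbrs
    by (auto simp: J_def)
  have IJ: "insert j (I \<union> J) = nbrs E r" "I \<inter> J = {}" "j \<notin> I \<union> J"
    using I by (auto simp: J_def)
  have "card (nbrs E r) = Suc (card (I \<union> J))"
    using IJ fin by (metis card_insert_disjoint finite_Un)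
  then have card: "Suc (card I + card J) = d"
    using card_Un_disjoint[OF fin IJ(2)] card_nbrs[OF I(2)] by simp
  obtain g where g: "indep_choice r (I \<union> J) g" "\<forall>i\<in>I. g i = f i"
    using indep_choice_extend_many[OF fin(2) f I(1) _ IJ(2)] card by (auto simp: J_def)
  have gJ: "indep_choice r J g" using g(1) unfolding indep_choice_def by auto
  let ?B = "\<lambda>K. \<Union>i\<in>K. nbrs E (g i) \<inter> (nbrs E j - {r})"
  have "?B (I \<union> J) = ?B I \<union> ?B J" by blast
  then have "card (?B (I \<union> J)) \<le> card (?B I) + card (?B J)" by (metis card_Un_le)
  moreover have "card (?B I) < card I" using small g(2) by simp
  moreover have "card (?B J) \<le> card J"
    using gJ I by (intro card_blocked_le) (auto simp: J_def)
  ultimately have "card (?B (I \<union> J)) < d - 1" using card by linarith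
  moreover have "I \<union> J \<subseteq> nbrs E r" using IJ(1) by blast
  ultimately show ?thesis
    using indep_choice_extend[OF g(1) _ I(2) IJ(3)] IJ(1) by metis
qed

lemma indep_choice_exists: "\<exists>f. indep_choice r (nbrs E r) f"
proof (cases "nbrs E r = {}")
  case True
  then show ?thesis by (simp add: indep_choice_def)
next
  case False
  then obtain i where i: "i \<in> nbrs E r" by blast
  have "card (nbrs E i - {r}) \<noteq> 0" using card_second_nbrs[OF i] two_le_degree by simp
  then obtain b where b: "b \<in> nbrs E i - {r}" by (metis card.empty ex_in_conv)
  have dr: "card (nbrs E r - {i}) = d - 1" using i card_nbrs[OF i] by (simp add: finite_nbrs)
  show ?thesis
  proof (cases "\<exists>j \<in> nbrs E r - {i}. nbrs E b \<inter> (nbrs E j - {r}) = {}")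
    case True
    then obtain j where j: "j \<in> nbrs E r - {i}" "nbrs E b \<inter> (nbrs E j - {r}) = {}" by blast
    then show ?thesis using i b nbrs_irrefl
      by (intro indep_choice_complete[of "{i}" "\<lambda>_. b" j]) (auto simp: indep_choice_def)
  next
    case False
    \<comment> \<open>This yields a third neighbour of \<open>r\<close>: for \<open>d = 2\<close>, a
      common neighbour of \<open>b\<close> and the only other neighbour of \<open>r\<close> would
      close a pentagon.\<close>
    have third: "d \<noteq> 2"
    proof
      assume "d = 2"
      have "card (nbrs E r - {i}) \<noteq> 0" using dr two_le_degree by simp
      then obtain j where j: "j \<in> nbrs E r - {i}" by (metis card.empty ex_in_conv)
      obtain y where y: "y \<in> nbrs E b" "y \<in> nbrs E j" "y \<noteq> r" using False j by blast
      have "distinct [r, i, b, y, j]"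
      proof -
        have "r \<in> nbrs E i" "j \<in> nbrs E r" using i j nbrs_sym by fast+
        then have "i \<notin> nbrs E j" by (rule no_triangle[rotated])
        moreover from this have "j \<notin> nbrs E i" by (simp add: nbrs_sym[of j])
        ultimately have "y \<noteq> i" "j \<noteq> b" using y b by auto
        moreover have "r \<noteq> i" "r \<noteq> j" "i \<noteq> b" "b \<noteq> y" "y \<noteq> j"
          using i b j y nbrs_irrefl by auto
        ultimately show ?thesis using b j y(3) by auto
      qed
      then show False
        using no_pentagon[OF \<open>d = 2\<close>, of r i b y j] i b j y nbrs_sym by (metis DiffE)
    qed
    then have "2 \<le> card (nbrs E r - {i})" using dr two_le_degree by simp
    then obtain T where "T \<subseteq> nbrs E r - {i}" "card T = 2"
      using obtain_subset_with_card_n by metis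
    then obtain j k where jk: "j \<in> nbrs E r - {i}" "k \<in> nbrs E r - {i}" "j \<noteq> k"
      by (auto simp: card_2_iff)
    obtain y where y: "y \<in> nbrs E b" "y \<in> nbrs E j - {r}" using False jk(1) by blast
    obtain z where z: "z \<in> nbrs E b" "z \<in> nbrs E k - {r}" using False jk(2) by blast
    txt \<open>\<open>y\<close> and \<open>z\<close> block the same vertex \<open>b\<close>, so one vertex is saved in the last part.\<close>
    define f where "f = (\<lambda>_. z)(j := y)"
    have yz: "y \<notin> nbrs E z" "z \<notin> nbrs E y" using y z no_triangle nbrs_sym by metis+
    have f: "indep_choice r {j, k} f"
      using y z yz jk(3) nbrs_irrefl by (auto simp: indep_choice_def f_def)
    \<comment> \<open>Here \<open>b\<close> is a common neighbour of \<open>x\<close> and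
      \<open>i\<close>, and there is no second one.\<close>
    have "nbrs E x \<inter> (nbrs E i - {r}) = {b}" if "x \<in> nbrs E b" "x \<in> nbrs E l - {r}"
      "l \<in> nbrs E r" for x l
      using that b second_nbr_unique[OF that(3) i that(2)] nbrs_sym by fast
    then have "nbrs E y \<inter> (nbrs E i - {r}) = {b}" "nbrs E z \<inter> (nbrs E i - {r}) = {b}"
      using y z jk by blast+
    then have "(\<Union>l\<in>{j, k}. nbrs E (f l) \<inter> (nbrs E i - {r})) = {b}"
      using jk(3) by (auto simp: f_def)
    then have "card (\<Union>l\<in>{j, k}. nbrs E (f l) \<inter> (nbrs E i - {r})) < card {j, k}"
      using jk(3) by simp
    then show ?thesis using jk i by (intro indep_choice_complete[OF f]) auto
  qed
qed

text \<open>The edges are \<open>{i, f i}\<close>. A link between two of them is a triangle if it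
  joins \<open>i\<close> and \<open>j\<close>, a square if it joins \<open>f i\<close> and
  \<open>j\<close>, and is ruled out by the choice of \<open>f\<close> if it joins
  \<open>f i\<close> and \<open>f j\<close>.\<close>

lemma star_matching:
  assumes "nbrs E r \<noteq> {}"
  obtains T where "T \<subseteq> E" "card T = d"
    "\<And>t. t \<in> T \<Longrightarrow> r \<notin> t \<and> t \<inter> nbrs E r \<noteq> {}"
    "\<And>s t. s \<in> T \<Longrightarrow> t \<in> T \<Longrightarrow> s \<noteq> t \<Longrightarrow> \<not> within_distance_two E s t"
proof -
  obtain f where "indep_choice r (nbrs E r) f" using indep_choice_exists by blast
  then have f: "\<And>i. i \<in> nbrs E r \<Longrightarrow> f i \<in> nbrs E i \<and> f i \<noteq> r"
    and indep: "\<And>i j. i \<in> nbrs E r \<Longrightarrow> j \<in> nbrs E r \<Longrightarrow> f i \<notin> nbrs E (f j)"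
    unfolding indep_choice_def by auto
  have cross: "f i \<notin> nbrs E j" if "i \<in> nbrs E r" "j \<in> nbrs E r" "i \<noteq> j" for i j
    using that f[OF that(1)] no_square[of i j r "f i"] nbrs_sym by fast
  have far: "f i \<notin> nbrs E r" if "i \<in> nbrs E r" for i
    using that f[OF that] no_triangle nbrs_sym by fast
  \<comment> \<open>This gives both the injectivity of the map to edges and the absence of
    conflicts.\<close>
  have eq: "i = j" if "i \<in> nbrs E r" "j \<in> nbrs E r" "within_distance_two E {i, f i} {j, f j}"
    for i j
  proof (rule ccontr)
    assume "i \<noteq> j"
    then have "f i \<notin> nbrs E j" "f j \<notin> nbrs E i" "f i \<notin> nbrs E (f j)" "j \<notin> nbrs E i"
      using that(1,2) cross indep no_triangle nbrs_sym by metis+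
    moreover have "f i \<noteq> j" "f j \<noteq> i" "f i \<noteq> f j"
      using far that(1,2) f cross \<open>i \<noteq> j\<close> by metis+
    ultimately show False
      using that(3) \<open>i \<noteq> j\<close> unfolding within_distance_two_def
      by (auto simp: nbrs_def insert_commute)
  qed
  let ?T = "(\<lambda>i. {i, f i}) ` nbrs E r"
  have inj: "inj_on (\<lambda>i. {i, f i}) (nbrs E r)"
  proof (rule inj_onI)
    fix i j assume "i \<in> nbrs E r" "j \<in> nbrs E r" "{i, f i} = {j, f j}"
    then show "i = j" by (intro eq) (auto simp: within_distance_two_def)
  qed
  show thesis
  proof
    show "?T \<subseteq> E" using f by (auto simp: nbrs_def)
    show "card ?T = d" using inj assms card_nbrs by (auto simp: card_image)
    show "r \<notin> t \<and> t \<inter> nbrs E r \<noteq> {}" if "t \<in> ?T" for t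
      using that f nbrs_irrefl by auto
    show "\<not> within_distance_two E s t" if "s \<in> ?T" "t \<in> ?T" "s \<noteq> t" for s t
      using that eq by auto
  qed
qed

end

section \<open>Components and their roots\<close>

definition adj :: "('a \<times> 'a) set" where
  "adj = {(v, w). w \<in> nbrs E v}"

lemma conn_sym: "(v, w) \<in> adj\<^sup>* \<Longrightarrow> (w, v) \<in> adj\<^sup>*"
  by (rule symD[OF sym_rtrancl]) (auto simp: sym_def adj_def nbrs_sym)

text \<open>All vertices of a component yield the same predicate, so the choice operator returns the
  same root for all of them.\<close>

definition root :: "'a \<Rightarrow> 'a" where
  "root v = (SOME r. (v, r) \<in> adj\<^sup>*)"

lemma root_conn: "(v, root v) \<in> adj\<^sup>*"
  unfolding root_def by (rule someI[of _ v]) simp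

lemma root_eq: "(v, w) \<in> adj\<^sup>* \<Longrightarrow> root v = root w"
  unfolding root_def by (rule arg_cong[of _ _ Eps]) (meson conn_sym rtrancl_trans)

lemma root_nbr: "w \<in> nbrs E v \<Longrightarrow> root w = root v"
  by (rule root_eq[symmetric]) (auto simp: adj_def)

lemma root_edge: "e \<in> E \<Longrightarrow> v \<in> e \<Longrightarrow> w \<in> e \<Longrightarrow> root v = root w"
  using root_nbr by (metis edge_form insertE singletonD)

text \<open>A path from outside \<open>U\<close> into \<open>U\<close> has a first step that enters
  it. Later \<open>U\<close> is the set of vertices touched by the uncoloured edges under
  consideration.\<close>

lemma crossing_edge:
  assumes "(v, w) \<in> adj\<^sup>*" "v \<notin> U" "w \<in> U"
  shows "\<exists>p u. p \<notin> U \<and> u \<in> U \<and> u \<in> nbrs E p"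
  using assms by (induction rule: rtrancl_induct) (auto simp: adj_def)

section \<open>The colouring itself\<close>

lemma few_colors:
  "\<exists>c :: 'a set \<Rightarrow> nat. strong_edge_coloring E c \<and> card (c ` E) \<le> 2 * d * (d - 1) - d + 2"
proof -
  \<comment> \<open>One more than the largest number of remaining conflicts; the colours below
    \<open>k\<close> serve the edges outside \<open>M\<close>, and \<open>k\<close> itself is kept
    for \<open>M\<close>.\<close>
  define k where "k = 2 * d * (d - 1) - d + 1"
  define R where "R = {r. root r = r \<and> nbrs E r \<noteq> {}}"
  have "\<exists>T. T \<subseteq> E \<and> card T = d \<and> (\<forall>t\<in>T. r \<notin> t \<and> t \<inter> nbrs E r \<noteq> {}) \<and>
      (\<forall>s\<in>T. \<forall>t\<in>T. s \<noteq> t \<longrightarrow> \<not> within_distance_two E s t)" if "r \<in> R" for r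
    using star_matching[of r] that unfolding R_def by (metis (mono_tags) mem_Collect_eq)
  then have "\<exists>T. \<forall>r\<in>R. T r \<subseteq> E \<and> card (T r) = d \<and>
      (\<forall>t\<in>T r. r \<notin> t \<and> t \<inter> nbrs E r \<noteq> {}) \<and>
      (\<forall>s\<in>T r. \<forall>t\<in>T r. s \<noteq> t \<longrightarrow> \<not> within_distance_two E s t)"
    by (intro bchoice) blast
  then obtain T where T: "\<forall>r\<in>R. T r \<subseteq> E \<and> card (T r) = d \<and>
      (\<forall>t\<in>T r. r \<notin> t \<and> t \<inter> nbrs E r \<noteq> {}) \<and>
      (\<forall>s\<in>T r. \<forall>t\<in>T r. s \<noteq> t \<longrightarrow> \<not> within_distance_two E s t)" by blast
  have T_edges: "t \<in> E" and T_root: "r \<notin> t" and T_meets: "t \<inter> nbrs E r \<noteq> {}"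
    if "r \<in> R" "t \<in> T r" for r t
    using bspec[OF T that(1)] that(2) by blast+
  have T_card: "card (T r) = d" if "r \<in> R" for r
    using bspec[OF T that] by simp
  have T_indep: "\<not> within_distance_two E s t" if "r \<in> R" "s \<in> T r" "t \<in> T r" "s \<noteq> t" for r s t
    using bspec[OF T that(1)] that(2-4) by simp
  define M where "M = (\<Union>r\<in>R. T r)"
  have root_T: "root v = r" if rtv: "r \<in> R" "t \<in> T r" "v \<in> t" for r t v
  proof -
    have r: "root r = r" using rtv(1) by (simp add: R_def)
    obtain x where x: "x \<in> t" "x \<in> nbrs E r" using T_meets[OF rtv(1,2)] by blast
    then show ?thesis using root_edge[OF T_edges[OF rtv(1,2)] rtv(3) x(1)] root_nbr[OF x(2)] r by simp
  qed
  have root_close: "root v = root w"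
    if close: "within_distance_two E e f" "e \<in> E" "f \<in> E" "v \<in> e" "w \<in> f" for e f v w
  proof -
    obtain x y where xy: "x \<in> e" "y \<in> f" "x = y \<or> y \<in> nbrs E x"
      using close(1) by (auto simp: within_distance_two_def nbrs_def)
    have "root x = root y" using xy(3) root_nbr[of y x] by metis
    moreover have "root v = root x" "root w = root y"
      using close xy root_edge by blast+
    ultimately show ?thesis by simp
  qed
  \<comment> \<open>Edges of different components never conflict, so the matchings of all roots can
    share one colour.\<close>
  have M: "\<not> within_distance_two E s t" if st: "s \<in> M" "t \<in> M" "s \<noteq> t" for s t
  proof
    assume close: "within_distance_two E s t"
    obtain p q where pq: "p \<in> R" "s \<in> T p" "q \<in> R" "t \<in> T q" using st M_def by auto
    then obtain v w where "v \<in> s" "w \<in> t" using T_meets by blast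
    then have "p = q" using root_close[OF close] root_T T_edges pq by metis
    then show False using T_indep pq close st(3) by blast
  qed
  have deg: "\<exists>y\<in>Y. card {z \<in> Y. z \<noteq> y \<and> within_distance_two E y z} < k"
    if Y: "Y \<subseteq> E - M" "Y \<noteq> {}" for Y
  proof -
    \<comment> \<open>The set \<open>F\<close> consists of \<open>d\<close> conflicts of
      \<open>y\<close> that lie outside \<open>Y\<close>: the matching of a root on
      \<open>y\<close>, or all edges at an untouched vertex next to \<open>y\<close>.\<close>
    have "\<exists>y\<in>Y. \<exists>F \<subseteq> {z \<in> E. z \<noteq> y \<and> within_distance_two E y z}. F \<inter> Y = {} \<and> card F = d"
    proof (cases "\<exists>r\<in>R. \<exists>y\<in>Y. r \<in> y")
      case True
      then obtain r y where r: "r \<in> R" "y \<in> Y" "r \<in> y" by blast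
      have "T r \<subseteq> M" using r M_def by auto
      moreover have "within_distance_two E y t" if "t \<in> T r" for t
        using T_meets[OF r(1) that] r(3) unfolding within_distance_two_def nbrs_def by blast
      ultimately have "T r \<subseteq> {z \<in> E. z \<noteq> y \<and> within_distance_two E y z}"
        "T r \<inter> Y = {}" "card (T r) = d"
        using T_edges T_card T_root r Y(1) by blast+
      then show ?thesis using r(2) by blast
    next
      case False
      obtain e where e: "e \<in> Y" using Y(2) by blast
      then have "e \<in> E" using Y(1) by blast
      then obtain w where w: "w \<in> e" using edge_card[of e] by fastforce
      then have wnbr: "nbrs E w \<noteq> {}" using edge_form[OF \<open>e \<in> E\<close> w] by blast
      have conn: "(root w, w) \<in> adj\<^sup>*" by (rule conn_sym) (rule root_conn)
      \<comment> \<open>Either the root is \<open>w\<close>, or the path to \<open>w\<close> starts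
        with an edge at the root.\<close>
      have "nbrs E (root w) \<noteq> {}"
        using conn wnbr by (cases rule: converse_rtranclE) (auto simp: adj_def)
      moreover have "root (root w) = root w" using root_eq[OF root_conn] by metis
      ultimately have "root w \<in> R" by (simp add: R_def)
      then have "root w \<notin> \<Union> Y" using False by blast
      moreover have "w \<in> \<Union> Y" using w e by blast
      ultimately obtain p u where pu: "p \<notin> \<Union> Y" "u \<in> \<Union> Y" "u \<in> nbrs E p"
        using crossing_edge[OF conn] by metis
      then obtain y where y: "y \<in> Y" "u \<in> y" by blast
      have "within_distance_two E y z" if "p \<in> z" for z
        using that y(2) pu(3) nbrs_sym[of u E p] unfolding within_distance_two_def nbrs_def
        by blast
      then have "{z \<in> E. p \<in> z} \<subseteq> {z \<in> E. z \<noteq> y \<and> within_distance_two E y z}"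
        using pu(1) y(1) by blast
      moreover have "{z \<in> E. p \<in> z} \<inter> Y = {}" using pu(1) by blast
      ultimately show ?thesis using y(1) card_edges_at[OF pu(3)] by blast
    qed
    then obtain y F where y: "y \<in> Y" and F: "F \<subseteq> {z \<in> E. z \<noteq> y \<and> within_distance_two E y z}"
      "F \<inter> Y = {}" "card F = d" by blast
    let ?C = "{z \<in> E. z \<noteq> y \<and> within_distance_two E y z}"
    have "{z \<in> Y. z \<noteq> y \<and> within_distance_two E y z} \<subseteq> ?C - F" using F(2) Y(1) by blast
    then have "card {z \<in> Y. z \<noteq> y \<and> within_distance_two E y z} \<le> card (?C - F)"
      by (rule card_mono[rotated]) (simp add: finite_edges)
    also have "\<dots> = card ?C - d"
      using F finite_edges by (subst card_Diff_subset) (auto intro: finite_subset)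
    also have "\<dots> < k"
      using card_conflicts_le[of y] y Y(1) unfolding k_def by fastforce
    finally show ?thesis using y by blast
  qed
  obtain c where c: "\<forall>x\<in>E - M. c x < k"
    "\<forall>x\<in>E - M. \<forall>y\<in>E - M. x \<noteq> y \<and> within_distance_two E x y \<longrightarrow> c x \<noteq> c y"
    using degenerate_coloring[OF finite_Diff[OF finite_edges], OF within_distance_two_sym deg]
    by metis
  define c' where "c' e = (if e \<in> M then k else c e)" for e
  have "strong_edge_coloring E c'"
    unfolding strong_edge_coloring_def
  proof (intro ballI impI)
    fix e f assume ef: "e \<in> E" "f \<in> E" "e \<noteq> f \<and> within_distance_two E e f"
    then show "c' e \<noteq> c' f"
      using M[of e f] c unfolding c'_def
      by (cases "e \<in> M"; cases "f \<in> M") (auto dest: less_not_refl2 less_not_refl3)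
  qed
  moreover have "c' ` E \<subseteq> {..k}" using c(1) by (auto simp: c'_def intro: less_imp_le)
  then have "card (c' ` E) \<le> card {..k}" by (rule card_mono[rotated]) simp
  then have "card (c' ` E) \<le> 2 * d * (d - 1) - d + 2" by (simp add: k_def)
  ultimately show ?thesis by blast
qed

end

section \<open>From the girth to the forbidden cycles\<close>

lemma girth_le: "is_cycle E p \<Longrightarrow> girth E \<le> enat (length p)"
  unfolding girth_def by (rule INF_lower) simp

lemma regular_girth_graph_of_girth:
  assumes "simple_graph V E" "regular V E d" "girth E \<ge> 5" "\<not> (d = 2 \<and> girth E = 5)" "2 \<le> d"
  shows "regular_girth_graph E d"
proof
  have E: "finite V" "\<And>e. e \<in> E \<Longrightarrow> e \<subseteq> V \<and> card e = 2"
    using assms(1) by (auto simp: simple_graph_def)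
  have irrefl: "v \<notin> nbrs E v" for v using E(2)[of "{v}"] by (auto simp: nbrs_def)
  then have ne: "v \<noteq> w" if "w \<in> nbrs E v" for v w using that by blast
  have short: "\<not> is_cycle E p" if "length p < 5" for p
  proof
    assume "is_cycle E p"
    then have "(5::enat) \<le> enat (length p)" using girth_le assms(3) order_trans by blast
    then show False using that by (simp add: numeral_eq_enat)
  qed
  show "finite E" using E by (meson PowI finite_Pow_iff finite_subset subsetI)
  show "card e = 2" if "e \<in> E" for e using E(2) that by blast
  show "2 \<le> d" by fact
  show "card (nbrs E v) = d" if "w \<in> nbrs E v" for v w
  proof -
    have "v \<in> V" using that E(2)[of "{v, w}"] by (simp add: nbrs_def)
    have "{e \<in> E. v \<in> e} = (\<lambda>w. {v, w}) ` nbrs E v"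
      using E(2) by (fastforce simp: nbrs_def card_2_iff insert_commute)
    moreover have "inj_on (\<lambda>w. {v, w}) (nbrs E v)"
      by (auto simp: inj_on_def doubleton_eq_iff)
    ultimately show ?thesis
      using assms(2) \<open>v \<in> V\<close> by (auto simp: regular_def degree_def card_image)
  qed
  show "c \<notin> nbrs E a" if "a \<in> nbrs E b" "b \<in> nbrs E c" for a b c
  proof
    assume "c \<in> nbrs E a"
    then have "is_cycle E [c, b, a]"
      using that ne[OF that(1)] ne[OF that(2)] ne[of c a]
      by (auto simp: is_cycle_def nbrs_def All_less_Suc2)
    then show False using short[of "[c, b, a]"] by simp
  qed
  show "x = y" if "a \<noteq> b" "x \<in> nbrs E a" "x \<in> nbrs E b" "y \<in> nbrs E a" "y \<in> nbrs E b" for a b x y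
  proof (rule ccontr)
    assume "x \<noteq> y"
    then have "is_cycle E [a, x, b, y]"
      using that ne[of x a] ne[of x b] ne[of y a] ne[of y b] nbrs_sym[of x E b] nbrs_sym[of y E a]
      by (auto simp: is_cycle_def nbrs_def All_less_Suc2)
    then show False using short[of "[a, x, b, y]"] by simp
  qed
  show "v \<notin> nbrs E z" if "d = 2" "distinct [v, w, x, y, z]" "w \<in> nbrs E v" "x \<in> nbrs E w"
    "y \<in> nbrs E x" "z \<in> nbrs E y" for v w x y z
  proof
    assume "v \<in> nbrs E z"
    then have "is_cycle E [v, w, x, y, z]"
      using that
      by (auto simp: is_cycle_def nbrs_def All_less_Suc2)
    \<comment> \<open>Together with the lower bound the girth is exactly 5, the case excluded for
      \<open>d = 2\<close>.\<close>
    then have "girth E \<le> 5" using girth_le[of E "[v, w, x, y, z]"] by (simp add: numeral_eq_enat eval_nat_numeral)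
    then show False using assms(3,4) that(1) by simp
  qed
qed

text \<open>The last hypothesis excludes 2-regular graphs with a 5-cycle: its edges conflict
  pairwise and need 5 colours, while the bound is 4. The bound is an integer because truncated
  subtraction would give 2 instead of 1 at \<open>\<Delta> = 1\<close>.\<close>

theorem lemma3p2:
  fixes V :: "'a set" and E :: "'a set set" and \<Delta> :: nat
  assumes "simple_graph V E"
    and "regular V E \<Delta>"
    and "girth E \<ge> 5"
    and "\<not> (\<Delta> = 2 \<and> girth E = 5)"
  shows "\<exists>c :: 'a set \<Rightarrow> nat. strong_edge_coloring E c \<and>
           int (card (c ` E)) \<le> 2 * int \<Delta> ^ 2 - 3 * int \<Delta> + 2"
proof (cases "2 \<le> \<Delta>")
  case True
  then interpret regular_girth_graph E \<Delta>
    using regular_girth_graph_of_girth assms by blast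
  obtain c :: "'a set \<Rightarrow> nat"
    where c: "strong_edge_coloring E c" "card (c ` E) \<le> 2 * \<Delta> * (\<Delta> - 1) - \<Delta> + 2"
    using few_colors by blast
  \<comment> \<open>Writing the degree as \<open>n + 2\<close> removes the truncation from the
    natural subtractions.\<close>
  obtain n where n: "\<Delta> = n + 2" using True by (metis add.commute le_Suc_ex)
  have "int (2 * \<Delta> * (\<Delta> - 1) - \<Delta> + 2) = 2 * int \<Delta> ^ 2 - 3 * int \<Delta> + 2"
    unfolding n by (simp add: algebra_simps power2_eq_square of_nat_diff)
  then show ?thesis using c by (metis of_nat_le_iff)
next
  case False
  have E: "finite V" "\<And>e. e \<in> E \<Longrightarrow> e \<subseteq> V \<and> card e = 2"
    using assms(1) by (auto simp: simple_graph_def)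
  have "finite E" using E by (meson PowI finite_Pow_iff finite_subset subsetI)
  \<comment> \<open>For degree at most 1 the edges are pairwise disjoint; an edge linking two edges
    would equal both, so a single colour suffices.\<close>
  have same: "e = f" if "e \<in> E" "f \<in> E" "v \<in> e" "v \<in> f" for e f v
  proof -
    have "card {e \<in> E. v \<in> e} \<le> Suc 0"
      using assms(2) that E(2)[of e] False by (auto simp: regular_def degree_def)
    then show ?thesis using that \<open>finite E\<close> by (simp add: card_le_Suc0_iff_eq)
  qed
  have "strong_edge_coloring E (\<lambda>_. 0 :: nat)"
    unfolding strong_edge_coloring_def
  proof (intro ballI impI)
    fix e f assume ef: "e \<in> E" "f \<in> E" "e \<noteq> f \<and> within_distance_two E e f"
    then obtain x y where "x \<in> e" "y \<in> f" "{x, y} \<in> E"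
      using same unfolding within_distance_two_def by blast
    then have "e = f" using same[of e "{x, y}" x] same[of f "{x, y}" y] ef by simp
    then show "(0::nat) \<noteq> 0" using ef by simp
  qed
  moreover have "card ((\<lambda>_. 0 :: nat) ` E) \<le> 1"
    using card_mono[of "{0::nat}" "(\<lambda>_. 0) ` E"] by auto
  moreover have "1 \<le> 2 * int \<Delta> ^ 2 - 3 * int \<Delta> + 2"
    using False by (cases \<Delta>) (auto simp: not_le less_Suc_eq numeral_2_eq_2)
  ultimately show ?thesis by (meson of_nat_le_1_iff order_trans)
qed

end
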